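(* Let $V$ be an $\mathrm{FI}\sharp$-module over a field $k$. The following are equivalent: (1) $\dim_k(V_n)$ is bounded above by a polynomial in $n$; (2) $\dim_k(V_n)$ is exactly equal to a polynomial in $n$ for all $n\ge 0$.
   Context: $\mathrm{FI}\sharp$ is the category whose objects are finite sets and whose morphisms from $S$ to $T$ are partial injections: triples $(A,B,\phi)$ with $A\subseteq S$, $B\subseteq T$ and $\phi\colon A\to B$ a bijection. The composition of $(A,B,\phi)\colon S\to T$ with $(C,D,\psi)\colon T\to U$ is $(\phi^{-1}(B\cap C),\psi(B\cap C),\psi\circ\phi)$. An $\mathrm{FI}\sharp$-module over $k$ is a functor $V$ from $\mathrm{FI}\sharp$ to $k$-modules, and $V_n=V(\{1,\dots,n\})$. *)

theory Defs
  imports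
    "Jordan_Normal_Form.Missing_VectorSpace"
    "HOL-Computational_Algebra.Polynomial"
begin

text \<open>
  The category \<open>FI\<sharp>\<close> of finite sets and partial injections. Its objects are the finite sets
  of elements of a label type. HOL has no type of all sets; the label type \<open>nat\<close> is enough to
  contain every set \<open>{1..n}\<close>, and a functor defined on any larger supply of finite sets restricts
  to the finite sets of naturals without changing its values there.

  A morphism is a triple \<open>(A, B, \<phi>)\<close> with \<open>\<phi>\<close> a bijection from \<open>A\<close> to \<open>B\<close>. Since \<open>\<phi>\<close> is a total
  HOL function, it is required to be extensional (\<open>undefined\<close> outside \<open>A\<close>), so that equality of
  triples is equality of partial injections.
\<close>

type_synonym 'a partial_inj = "'a set \<times> 'a set \<times> ('a \<Rightarrow> 'a)"

definition FIsharp_hom :: "'a set \<Rightarrow> 'a set \<Rightarrow> 'a partial_inj set" where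
  "FIsharp_hom S T =
     {(A, B, \<phi>). A \<subseteq> S \<and> B \<subseteq> T \<and> bij_betw \<phi> A B \<and> \<phi> \<in> extensional A}"

definition FIsharp_id :: "'a set \<Rightarrow> 'a partial_inj" where
  "FIsharp_id S = (S, S, restrict (\<lambda>x. x) S)"

text \<open>\<open>FIsharp_comp g f\<close> is ``first \<open>f\<close>, then \<open>g\<close>''.\<close>

fun FIsharp_comp :: "'a partial_inj \<Rightarrow> 'a partial_inj \<Rightarrow> 'a partial_inj" where
  "FIsharp_comp (C, D, \<psi>) (A, B, \<phi>) =
     (\<phi> -` (B \<inter> C) \<inter> A, \<psi> ` (B \<inter> C), restrict (\<psi> \<circ> \<phi>) (\<phi> -` (B \<inter> C) \<inter> A))"

lemma FIsharp_id_in_hom: "FIsharp_id S \<in> FIsharp_hom S S"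
  by (auto simp: FIsharp_id_def FIsharp_hom_def bij_betw_def inj_on_def)

lemma FIsharp_comp_in_hom:
  assumes "f \<in> FIsharp_hom S T" "g \<in> FIsharp_hom T U"
  shows "FIsharp_comp g f \<in> FIsharp_hom S U"
proof -
  obtain A B \<phi> where f: "f = (A, B, \<phi>)" by (cases f)
  obtain C D \<psi> where g: "g = (C, D, \<psi>)" by (cases g)
  have *: "A \<subseteq> S" "D \<subseteq> U" "inj_on \<phi> A" "\<phi> ` A = B" "inj_on \<psi> C" "\<psi> ` C = D"
    using assms by (simp_all add: f g FIsharp_hom_def bij_betw_def)
  have im: "\<phi> ` (\<phi> -` (B \<inter> C) \<inter> A) = B \<inter> C"
    using *(4) by auto
  have inj: "inj_on (\<psi> \<circ> \<phi>) (\<phi> -` (B \<inter> C) \<inter> A)"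
  proof (rule comp_inj_on)
    show "inj_on \<phi> (\<phi> -` (B \<inter> C) \<inter> A)" using *(3) by (rule inj_on_subset) auto
    show "inj_on \<psi> (\<phi> ` (\<phi> -` (B \<inter> C) \<inter> A))"
      unfolding im using *(5) by (rule inj_on_subset) auto
  qed
  have img: "(\<psi> \<circ> \<phi>) ` (\<phi> -` (B \<inter> C) \<inter> A) = \<psi> ` (B \<inter> C)"
    unfolding image_comp [symmetric] im ..
  have "\<phi> -` (B \<inter> C) \<inter> A \<subseteq> S" "\<psi> ` (B \<inter> C) \<subseteq> U"
    using *(1,2,6) by blast+
  then show ?thesis
    using inj img by (simp add: f g FIsharp_hom_def bij_betw_def)
qed

lemma FIsharp_comp_id_left:
  assumes "f \<in> FIsharp_hom S T"
  shows "FIsharp_comp (FIsharp_id T) f = f"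
proof -
  obtain A B \<phi> where f: "f = (A, B, \<phi>)" by (cases f)
  have *: "B \<subseteq> T" "\<phi> ` A = B" "\<phi> \<in> extensional A"
    using assms by (simp_all add: f FIsharp_hom_def bij_betw_def)
  have dom: "\<phi> -` (B \<inter> T) \<inter> A = A" using *(1,2) by blast
  have ran: "restrict (\<lambda>x. x) T ` (B \<inter> T) = B" using *(1) by force
  have "restrict (restrict (\<lambda>x. x) T \<circ> \<phi>) A x = \<phi> x" for x
  proof (cases "x \<in> A")
    case True
    then have "\<phi> x \<in> T" using *(1,2) by blast
    then show ?thesis using True by simp
  next
    case False
    then show ?thesis using *(3) by (simp add: extensional_def)
  qed
  then have "restrict (restrict (\<lambda>x. x) T \<circ> \<phi>) A = \<phi>" by (rule ext)
  then show ?thesis unfolding f FIsharp_id_def FIsharp_comp.simps dom ran by simp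
qed

lemma FIsharp_comp_id_right:
  assumes "f \<in> FIsharp_hom S T"
  shows "FIsharp_comp f (FIsharp_id S) = f"
proof -
  obtain A B \<phi> where f: "f = (A, B, \<phi>)" by (cases f)
  have *: "A \<subseteq> S" "\<phi> ` A = B" "\<phi> \<in> extensional A"
    using assms by (simp_all add: f FIsharp_hom_def bij_betw_def)
  have dom: "restrict (\<lambda>x. x) S -` (S \<inter> A) \<inter> S = A"
    using *(1) by (simp add: set_eq_iff vimage_def subset_iff) blast
  have ran: "\<phi> ` (S \<inter> A) = B" using *(1,2) by blast
  have "restrict (\<phi> \<circ> restrict (\<lambda>x. x) S) A x = \<phi> x" for x
  proof (cases "x \<in> A")
    case True
    then have "x \<in> S" using *(1) by blast
    then show ?thesis using True by simp
  next
    case False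
    then show ?thesis using *(3) by (simp add: extensional_def)
  qed
  then have "restrict (\<phi> \<circ> restrict (\<lambda>x. x) S) A = \<phi>" by (rule ext)
  then show ?thesis unfolding f FIsharp_id_def FIsharp_comp.simps dom ran by simp
qed

lemma FIsharp_comp_assoc:
  assumes "f \<in> FIsharp_hom S T" "g \<in> FIsharp_hom T U" "h \<in> FIsharp_hom U W"
  shows "FIsharp_comp h (FIsharp_comp g f) = FIsharp_comp (FIsharp_comp h g) f"
proof -
  obtain A B \<phi> where f: "f = (A, B, \<phi>)" by (cases f)
  obtain C D \<psi> where g: "g = (C, D, \<psi>)" by (cases g)
  obtain E F \<theta> where h: "h = (E, F, \<theta>)" by (cases h)
  have B: "\<phi> ` A = B" and D: "\<psi> ` C = D"
    using assms by (simp_all add: f g FIsharp_hom_def bij_betw_def)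
  define X where "X = {x \<in> A. \<phi> x \<in> C \<and> \<psi> (\<phi> x) \<in> E}"
  have dom1: "restrict (\<psi> \<circ> \<phi>) (\<phi> -` (B \<inter> C) \<inter> A) -` (\<psi> ` (B \<inter> C) \<inter> E)
      \<inter> (\<phi> -` (B \<inter> C) \<inter> A) = X"
    unfolding X_def B [symmetric] by auto
  have dom2: "\<phi> -` (B \<inter> (\<psi> -` (D \<inter> E) \<inter> C)) \<inter> A = X"
    unfolding X_def B [symmetric] D [symmetric] by auto
  have ran: "restrict (\<theta> \<circ> \<psi>) (\<psi> -` (D \<inter> E) \<inter> C) ` (B \<inter> (\<psi> -` (D \<inter> E) \<inter> C))
      = \<theta> ` (\<psi> ` (B \<inter> C) \<inter> E)" (is "?l = ?r")
  proof -
    have "?l = (\<theta> \<circ> \<psi>) ` (B \<inter> (\<psi> -` (D \<inter> E) \<inter> C))"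
      by (rule image_cong) simp_all
    also have "\<dots> = \<theta> ` (\<psi> ` (B \<inter> (\<psi> -` (D \<inter> E) \<inter> C)))"
      by (simp add: image_comp)
    also have "\<psi> ` (B \<inter> (\<psi> -` (D \<inter> E) \<inter> C)) = \<psi> ` (B \<inter> C) \<inter> E"
      unfolding D [symmetric] by blast
    finally show ?thesis .
  qed
  have map: "restrict (\<theta> \<circ> restrict (\<psi> \<circ> \<phi>) (\<phi> -` (B \<inter> C) \<inter> A)) X
      = restrict (restrict (\<theta> \<circ> \<psi>) (\<psi> -` (D \<inter> E) \<inter> C) \<circ> \<phi>) X"
  proof (rule restrict_ext)
    fix x assume "x \<in> X"
    then have "x \<in> \<phi> -` (B \<inter> C) \<inter> A" "\<phi> x \<in> \<psi> -` (D \<inter> E) \<inter> C"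
      unfolding X_def B [symmetric] D [symmetric] by auto
    then show "(\<theta> \<circ> restrict (\<psi> \<circ> \<phi>) (\<phi> -` (B \<inter> C) \<inter> A)) x
        = (restrict (\<theta> \<circ> \<psi>) (\<psi> -` (D \<inter> E) \<inter> C) \<circ> \<phi>) x"
      by simp
  qed
  show ?thesis
    unfolding f g h FIsharp_comp.simps dom1 dom2 ran map ..
qed

text \<open>
  A functor from \<open>FI\<sharp>\<close> to \<open>R\<close>-modules: \<open>V S\<close> is the module attached to the finite set \<open>S\<close>, and
  \<open>Vmap S T f\<close> is the homomorphism induced by \<open>f\<close> from \<open>S\<close> to \<open>T\<close>. The source and target are
  explicit arguments because a triple does not determine them. The values of \<open>V\<close> and \<open>Vmap\<close> off
  finite sets, morphisms and carriers are irrelevant, so equality of homomorphisms is equality on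
  the carrier.
\<close>

locale FIsharp_module = cring R
  for R :: "('k, 'r) ring_scheme" (structure) +
  fixes V :: "'a set \<Rightarrow> ('k, 'v, 'm) module_scheme"
    and Vmap :: "'a set \<Rightarrow> 'a set \<Rightarrow> 'a partial_inj \<Rightarrow> 'v \<Rightarrow> 'v"
  assumes V_module: "finite S \<Longrightarrow> Module.module R (V S)"
    and Vmap_hom: "\<lbrakk>finite S; finite T; f \<in> FIsharp_hom S T\<rbrakk>
      \<Longrightarrow> Vmap S T f \<in> LinearCombinations.module_hom R (V S) (V T)"
    and Vmap_id: "\<lbrakk>finite S; x \<in> carrier (V S)\<rbrakk> \<Longrightarrow> Vmap S S (FIsharp_id S) x = x"
    and Vmap_comp: "\<lbrakk>finite S; finite T; finite U; f \<in> FIsharp_hom S T; g \<in> FIsharp_hom T U;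
        x \<in> carrier (V S)\<rbrakk>
      \<Longrightarrow> Vmap S U (FIsharp_comp g f) x = Vmap T U g (Vmap S T f x)"

end

theory Submission
  imports Defs
begin

text \<open>
  Morphisms in \<open>FI\<sharp>\<close> can forget points: for a point \<open>a\<close> outside \<open>S\<close> there is a restriction
  \<open>V (insert a S) \<rightarrow> V S\<close>, and it is split by the map that the inclusion induces. Hence every
  \<open>V S\<close> splits into pieces indexed by the subsets \<open>T\<close> of \<open>S\<close>, the piece at \<open>T\<close> being a copy of
  the subspace of those elements of \<open>V T\<close> that vanish as soon as any point of \<open>T\<close> is forgotten.
  Bijections of finite sets identify the pieces of equal cardinality, so for some numbers \<open>w j\<close>
  the dimension of \<open>V {1..n}\<close> is \<open>\<Sum>j\<le>n. (n choose j) * w j\<close> (\<open>dim_eq_binomial_sum\<close>).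

  The \<open>w j\<close> are nonnegative, and \<open>n choose j\<close> grows like \<open>n ^ j\<close>. A polynomial bound of degree
  \<open>d\<close> on the dimensions therefore forces \<open>w j = 0\<close> for all \<open>j > d\<close>. What remains is a fixed
  finite combination of binomial coefficients, that is, a polynomial in \<open>n\<close>, and the formula is
  valid from \<open>n = 0\<close> on (\<open>binomial_sum_poly_of_poly_bound\<close>).

  The direct sum is never formed. Only dimensions matter, and they are obtained by forgetting one
  point at a time and applying the rank-nullity theorem (\<open>kdim_insert\<close>). For this the induction
  has to run through the mixed subspaces \<open>killed S B\<close>, in which vanishing is required only for
  the points of \<open>B\<close>.
\<close>

section \<open>Dimensions of subspaces\<close>

text \<open>
  Independent subsets of \<open>W\<close> are independent in \<open>V\<close>, hence of bounded size; a maximal one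
  generates \<open>W\<close>.
\<close>

lemma (in vectorspace) fin_dim_subspace:
  assumes fd: "fin_dim" and W: "VectorSpace.subspace K W V"
  shows "vectorspace.fin_dim K (vs W)"
proof -
  interpret W: vectorspace K "vs W" by (rule subspace_is_vs[OF W])
  have sub: "submodule K W V" using W by simp
  then have WV: "W \<subseteq> carrier V" by (simp add: submodule_def)
  have small: "finite A \<and> card A \<le> dim"
    if "A \<subseteq> carrier (vs W) \<and> W.lin_indpt A" for A
    using that WV li_le_dim[OF fd, of A] span_li_not_depend(2)[OF _ sub, of A] by auto
  have "W.lin_indpt {}" by (auto simp: W.lin_dep_def)
  then have "\<exists>A. finite A \<and> maximal A (\<lambda>S. S \<subseteq> carrier (vs W) \<and> W.lin_indpt S)"
    using small by (intro maximal_exists[where N = dim and B = "{}"]) auto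
  then obtain A where A: "finite A"
      "maximal A (\<lambda>S. S \<subseteq> carrier (vs W) \<and> W.lin_indpt S)"
    by blast
  then have "W.gen_set A" by (intro W.max_li_is_gen)
  moreover have "A \<subseteq> carrier (vs W)" using A(2) by (simp add: maximal_def)
  ultimately show ?thesis using A(1) unfolding W.fin_dim_def by blast
qed

text \<open>The rank-nullity theorem for a map that is onto only between two given subspaces.\<close>

lemma dim_subspace_eq_image_plus_kernel:
  assumes V: "vectorspace K V" and W: "vectorspace K W"
    and fd: "vectorspace.fin_dim K V"
    and f: "f \<in> LinearCombinations.module_hom K V W"
    and X: "VectorSpace.subspace K X V" and Y: "VectorSpace.subspace K Y W" and im: "f ` X = Y"
  shows "vectorspace.dim K (V\<lparr>carrier := X\<rparr>) =
     vectorspace.dim K (W\<lparr>carrier := Y\<rparr>) +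
     vectorspace.dim K (V\<lparr>carrier := {x \<in> X. f x = \<zero>\<^bsub>W\<^esub>}\<rparr>)"
proof -
  interpret X: vectorspace K "V\<lparr>carrier := X\<rparr>" by (rule vectorspace.subspace_is_vs[OF V X])
  interpret Y: vectorspace K "W\<lparr>carrier := Y\<rparr>" by (rule vectorspace.subspace_is_vs[OF W Y])
  have XV: "X \<subseteq> carrier V" using X by (simp add: VectorSpace.subspace_def submodule_def)
  have "f \<in> LinearCombinations.module_hom K (V\<lparr>carrier := X\<rparr>) (W\<lparr>carrier := Y\<rparr>)"
    using f XV im by (auto simp: LinearCombinations.module_hom_def subset_iff)
  then interpret f: linear_map K "V\<lparr>carrier := X\<rparr>" "W\<lparr>carrier := Y\<rparr>" f
    by unfold_locales
  have "X.fin_dim" by (rule vectorspace.fin_dim_subspace[OF V fd X])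
  from f.rank_nullity[OF this] show ?thesis
    by (simp add: f.im_def f.ker_def im)
qed

lemma dim_subspace_eq_of_bij:
  assumes V: "vectorspace K V" and W: "vectorspace K W"
    and fd: "vectorspace.fin_dim K V"
    and f: "f \<in> LinearCombinations.module_hom K V W"
    and X: "VectorSpace.subspace K X V" and Y: "VectorSpace.subspace K Y W" and bij: "bij_betw f X Y"
  shows "vectorspace.dim K (V\<lparr>carrier := X\<rparr>) = vectorspace.dim K (W\<lparr>carrier := Y\<rparr>)"
proof -
  interpret X: vectorspace K "V\<lparr>carrier := X\<rparr>" by (rule vectorspace.subspace_is_vs[OF V X])
  interpret Y: vectorspace K "W\<lparr>carrier := Y\<rparr>" by (rule vectorspace.subspace_is_vs[OF W Y])
  have XV: "X \<subseteq> carrier V" using X by (simp add: VectorSpace.subspace_def submodule_def)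
  have "f \<in> LinearCombinations.module_hom K (V\<lparr>carrier := X\<rparr>) (W\<lparr>carrier := Y\<rparr>)"
    using f XV bij by (auto simp: LinearCombinations.module_hom_def subset_iff bij_betw_def)
  then interpret f: linear_map K "V\<lparr>carrier := X\<rparr>" "W\<lparr>carrier := Y\<rparr>" f
    by unfold_locales
  have "X.fin_dim" by (rule vectorspace.fin_dim_subspace[OF V fd X])
  from f.dim_eq[OF this] show ?thesis
    using bij by (simp add: bij_betw_def)
qed

section \<open>Partial injections given by restriction\<close>

text \<open>
  Describing a morphism by a total function and a domain, instead of by a triple, makes composition
  a matter of composing functions and intersecting domains. Restrictions and inclusions all arise
  from \<open>id\<close>.
\<close>

definition partial_inj_on :: "('a \<Rightarrow> 'a) \<Rightarrow> 'a set \<Rightarrow> 'a partial_inj" where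
  "partial_inj_on \<sigma> X = (X, \<sigma> ` X, restrict \<sigma> X)"

lemma partial_inj_on_in_hom:
  assumes "inj_on \<sigma> X" "X \<subseteq> S" "\<sigma> ` X \<subseteq> T"
  shows "partial_inj_on \<sigma> X \<in> FIsharp_hom S T"
  using assms by (auto simp: partial_inj_on_def FIsharp_hom_def bij_betw_def inj_on_def)

lemma FIsharp_comp_partial_inj_on:
  assumes "Z = {x \<in> X. \<sigma> x \<in> Y}" and "\<And>z. z \<in> Z \<Longrightarrow> \<rho> z = \<tau> (\<sigma> z)"
  shows "FIsharp_comp (partial_inj_on \<tau> Y) (partial_inj_on \<sigma> X) = partial_inj_on \<rho> Z"
proof -
  have dom: "restrict \<sigma> X -` (\<sigma> ` X \<inter> Y) \<inter> X = Z"
    using assms(1) by auto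
  have "\<sigma> ` X \<inter> Y = \<sigma> ` Z" "Z \<subseteq> X" "\<sigma> ` Z \<subseteq> Y" using assms(1) by auto
  then have "restrict \<tau> Y ` (\<sigma> ` X \<inter> Y) = \<rho> ` Z"
    using assms(2) by (force simp: image_image)
  moreover have "restrict (restrict \<tau> Y \<circ> restrict \<sigma> X) Z = restrict \<rho> Z"
    using assms by (intro restrict_ext) auto
  ultimately show ?thesis
    using dom by (simp add: partial_inj_on_def)
qed

section \<open>Elements of a functor that restrict to zero\<close>

locale FIsharp_vectorspace = FIsharp_module R V Vmap + field R
  for R :: "('k, 'r) ring_scheme" (structure)
    and V :: "'a set \<Rightarrow> ('k, 'v, 'm) module_scheme"
    and Vmap :: "'a set \<Rightarrow> 'a set \<Rightarrow> 'a partial_inj \<Rightarrow> 'v \<Rightarrow> 'v"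
begin

lemma V_vectorspace: "finite S \<Longrightarrow> vectorspace R (V S)"
  by (intro vectorspace.intro V_module field_axioms)

abbreviation act :: "'a set \<Rightarrow> 'a set \<Rightarrow> ('a \<Rightarrow> 'a) \<Rightarrow> 'a set \<Rightarrow> 'v \<Rightarrow> 'v" where
  "act S T \<sigma> X \<equiv> Vmap S T (partial_inj_on \<sigma> X)"

lemma act_hom:
  assumes "finite S" "finite T" "inj_on \<sigma> X" "X \<subseteq> S" "\<sigma> ` X \<subseteq> T"
  shows "act S T \<sigma> X \<in> LinearCombinations.module_hom R (V S) (V T)"
  using assms by (intro Vmap_hom partial_inj_on_in_hom)

lemma act_linear_map:
  assumes "finite S" "finite T" "inj_on \<sigma> X" "X \<subseteq> S" "\<sigma> ` X \<subseteq> T"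
  shows "linear_map R (V S) (V T) (act S T \<sigma> X)"
proof -
  interpret S: vectorspace R "V S" using assms(1) by (rule V_vectorspace)
  interpret T: vectorspace R "V T" using assms(2) by (rule V_vectorspace)
  show ?thesis using act_hom[OF assms] by unfold_locales
qed

lemma act_closed:
  assumes "finite S" "finite T" "inj_on \<sigma> X" "X \<subseteq> S" "\<sigma> ` X \<subseteq> T" "x \<in> carrier (V S)"
  shows "act S T \<sigma> X x \<in> carrier (V T)"
  using act_hom[OF assms(1-5)] assms(6) by (auto simp: LinearCombinations.module_hom_def)

lemma act_zero:
  assumes "finite S" "finite T" "inj_on \<sigma> X" "X \<subseteq> S" "\<sigma> ` X \<subseteq> T"
  shows "act S T \<sigma> X \<zero>\<^bsub>V S\<^esub> = \<zero>\<^bsub>V T\<^esub>"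
  using linear_map.T0_is_0[OF act_linear_map[OF assms]] .

lemma act_act:
  assumes "finite S" "finite T" "finite U"
    and "inj_on \<sigma> X" "X \<subseteq> S" "\<sigma> ` X \<subseteq> T"
    and "inj_on \<tau> Y" "Y \<subseteq> T" "\<tau> ` Y \<subseteq> U"
    and "x \<in> carrier (V S)"
    and "Z = {x \<in> X. \<sigma> x \<in> Y}" and "\<And>z. z \<in> Z \<Longrightarrow> \<rho> z = \<tau> (\<sigma> z)"
  shows "act T U \<tau> Y (act S T \<sigma> X x) = act S U \<rho> Z x"
  using Vmap_comp[of S T U "partial_inj_on \<sigma> X" "partial_inj_on \<tau> Y" x]
    FIsharp_comp_partial_inj_on[of Z X \<sigma> Y \<rho> \<tau>] assms
  by (simp add: partial_inj_on_in_hom)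

lemma act_id:
  assumes "finite S" "x \<in> carrier (V S)" "\<And>s. s \<in> S \<Longrightarrow> \<sigma> s = s"
  shows "act S S \<sigma> S x = x"
proof -
  have "partial_inj_on \<sigma> S = FIsharp_id S"
    using assms(3) by (auto simp: partial_inj_on_def FIsharp_id_def cong: restrict_cong)
  then show ?thesis using Vmap_id assms by simp
qed

text \<open>
  For \<open>B = {}\<close> this is all of \<open>V S\<close>. For \<open>B = S\<close> it is the part of \<open>V S\<close> that does not come
  from smaller sets, since each other piece of the decomposition of \<open>V S\<close> survives when a
  suitable point is forgotten.
\<close>

definition killed :: "'a set \<Rightarrow> 'a set \<Rightarrow> 'v set" where
  "killed S B =
     {x \<in> carrier (V S). \<forall>b\<in>B. act S (S - {b}) id (S - {b}) x = \<zero>\<^bsub>V (S - {b})\<^esub>}"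

definition kdim :: "'a set \<Rightarrow> 'a set \<Rightarrow> nat" where
  "kdim S B = vectorspace.dim R (V S\<lparr>carrier := killed S B\<rparr>)"

lemma killed_subspace:
  assumes "finite S"
  shows "VectorSpace.subspace R (killed S B) (V S)"
proof -
  interpret S: vectorspace R "V S" using assms(1) by (rule V_vectorspace)
  have lin: "linear_map R (V S) (V (S - {b})) (act S (S - {b}) id (S - {b}))" for b
    using assms by (intro act_linear_map) auto
  have "submodule R (killed S B) (V S)"
  proof (rule submodule.intro)
    show "Module.module R (V S)" by (rule S.module_axioms)
    show "killed S B \<subseteq> carrier (V S)" by (auto simp: killed_def)
    show "\<zero>\<^bsub>V S\<^esub> \<in> killed S B"
      using linear_map.T0_is_0[OF lin] by (auto simp: killed_def)
    show "v \<oplus>\<^bsub>V S\<^esub> w \<in> killed S B" if "v \<in> killed S B" "w \<in> killed S B" for v w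
    proof -
      have "act S (S - {b}) id (S - {b}) (v \<oplus>\<^bsub>V S\<^esub> w) = \<zero>\<^bsub>V (S - {b})\<^esub>" if "b \<in> B" for b
      proof -
        interpret b: linear_map R "V S" "V (S - {b})" "act S (S - {b}) id (S - {b})" by (rule lin)
        show ?thesis using that \<open>v \<in> killed S B\<close> \<open>w \<in> killed S B\<close> by (simp add: killed_def)
      qed
      then show ?thesis using that by (simp add: killed_def)
    qed
    show "c \<odot>\<^bsub>V S\<^esub> v \<in> killed S B" if "c \<in> carrier R" "v \<in> killed S B" for c v
    proof -
      have "act S (S - {b}) id (S - {b}) (c \<odot>\<^bsub>V S\<^esub> v) = \<zero>\<^bsub>V (S - {b})\<^esub>" if "b \<in> B" for b
      proof -
        interpret b: linear_map R "V S" "V (S - {b})" "act S (S - {b}) id (S - {b})" by (rule lin)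
        show ?thesis using that \<open>v \<in> killed S B\<close> \<open>c \<in> carrier R\<close>
          by (simp add: killed_def)
      qed
      then show ?thesis using that by (simp add: killed_def)
    qed
  qed
  then show ?thesis using S.vectorspace_axioms by (simp add: VectorSpace.subspace_def)
qed

text \<open>
  Forgetting \<open>\<sigma> a\<close> after applying \<open>\<sigma>\<close> is the same as forgetting \<open>a\<close> first. Thus vanishing
  at \<open>a\<close> is carried to vanishing at \<open>\<sigma> a\<close>, which covers bijections, restrictions and inclusions
  alike.
\<close>

lemma act_killed:
  assumes fin: "finite S" "finite T" and \<sigma>: "inj_on \<sigma> X" "X \<subseteq> S" "\<sigma> ` X \<subseteq> T"
    and B': "B' \<subseteq> \<sigma> ` (X \<inter> B)" and x: "x \<in> killed S B"
  shows "act S T \<sigma> X x \<in> killed T B'"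
proof -
  have xS: "x \<in> carrier (V S)" using x by (simp add: killed_def)
  have "act T (T - {b}) id (T - {b}) (act S T \<sigma> X x) = \<zero>\<^bsub>V (T - {b})\<^esub>" if b: "b \<in> B'" for b
  proof -
    obtain a where a: "a \<in> X" "a \<in> B" "b = \<sigma> a" using B' b by blast
    have inj': "inj_on \<sigma> (X - {a})" using \<sigma>(1) by (rule inj_on_subset) auto
    have im': "\<sigma> ` (X - {a}) \<subseteq> T - {b}" using \<sigma> a by (auto simp: inj_on_def)
    have "act T (T - {b}) id (T - {b}) (act S T \<sigma> X x) = act S (T - {b}) \<sigma> (X - {a}) x"
      using fin \<sigma> xS a by (intro act_act) (auto simp: inj_on_def)
    also have "\<dots> = act (S - {a}) (T - {b}) \<sigma> (X - {a}) (act S (S - {a}) id (S - {a}) x)"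
      using fin \<sigma>(2) xS inj' im' by (intro act_act [symmetric]) auto
    also have "act S (S - {a}) id (S - {a}) x = \<zero>\<^bsub>V (S - {a})\<^esub>"
      using x a(2) by (simp add: killed_def)
    also have "act (S - {a}) (T - {b}) \<sigma> (X - {a}) \<zero>\<^bsub>V (S - {a})\<^esub> = \<zero>\<^bsub>V (T - {b})\<^esub>"
      using fin \<sigma>(2) inj' im' by (intro act_zero) auto
    finally show ?thesis .
  qed
  then show ?thesis using act_closed[OF fin \<sigma> xS] by (simp add: killed_def)
qed

lemma bij_act:
  assumes fin: "finite S" "finite T" and \<sigma>: "bij_betw \<sigma> S T"
  shows "bij_betw (act S T \<sigma> S) (carrier (V S)) (carrier (V T))"
    and "bij_betw (act S T \<sigma> S) (killed S S) (killed T T)"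
proof -
  define \<tau> where "\<tau> = inv_into S \<sigma>"
  have \<tau>: "bij_betw \<tau> T S" unfolding \<tau>_def using \<sigma> by (rule bij_betw_inv_into)
  have \<sigma>': "inj_on \<sigma> S" "\<sigma> ` S = T" and \<tau>': "inj_on \<tau> T" "\<tau> ` T = S"
    using \<sigma> \<tau> by (simp_all add: bij_betw_def)
  have inv: "\<tau> (\<sigma> s) = s" if "s \<in> S" for s
    using that \<sigma>'(1) by (simp add: \<tau>_def)
  have inv': "\<sigma> (\<tau> t) = t" if "t \<in> T" for t
    using that \<sigma>'(2) by (simp add: \<tau>_def f_inv_into_f)
  have 1: "act T S \<tau> T (act S T \<sigma> S x) = x" if "x \<in> carrier (V S)" for x
  proof -
    have "act T S \<tau> T (act S T \<sigma> S x) = act S S id S x"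
      using fin \<sigma>' \<tau>' that inv by (intro act_act) auto
    then show ?thesis using act_id fin that by simp
  qed
  have 2: "act S T \<sigma> S (act T S \<tau> T x) = x" if "x \<in> carrier (V T)" for x
  proof -
    have "act S T \<sigma> S (act T S \<tau> T x) = act T T id T x"
      using fin \<sigma>' \<tau>' that inv' by (intro act_act) auto
    then show ?thesis using act_id fin that by simp
  qed
  show "bij_betw (act S T \<sigma> S) (carrier (V S)) (carrier (V T))"
    using fin \<sigma>' \<tau>' 1 2
    by (intro bij_betw_byWitness[where f' = "act T S \<tau> T"]) (auto intro!: act_closed)
  show "bij_betw (act S T \<sigma> S) (killed S S) (killed T T)"
  proof (rule bij_betw_byWitness[where f' = "act T S \<tau> T"])
    show "act S T \<sigma> S ` killed S S \<subseteq> killed T T"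
      using fin \<sigma>' by (intro image_subsetI act_killed[where B = S]) auto
    show "act T S \<tau> T ` killed T T \<subseteq> killed S S"
      using fin \<tau>' by (intro image_subsetI act_killed[where B = T]) auto
  qed (use 1 2 in \<open>auto simp: killed_def\<close>)
qed

lemma fin_dim_of_bij:
  assumes "finite S" "finite T" "bij_betw \<sigma> S T" "vectorspace.fin_dim R (V S)"
  shows "vectorspace.fin_dim R (V T)"
  using linear_map.surj_fin_dim[OF act_linear_map[of S T \<sigma> S]] assms bij_act(1)[of S T \<sigma>]
  by (simp add: bij_betw_def)

text \<open>
  Forgetting \<open>a\<close> maps \<open>killed (insert a S) B\<close> onto \<open>killed S B\<close>, with the inclusion providing
  preimages. Its kernel consists of the elements that vanish at \<open>a\<close> as well.
\<close>

lemma kdim_insert: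
  assumes fd: "vectorspace.fin_dim R (V (insert a S))"
    and fin: "finite S" and a: "a \<notin> S" and B: "B \<subseteq> S"
  shows "kdim (insert a S) B = kdim S B + kdim (insert a S) (insert a B)"
proof -
  let ?p = "act (insert a S) S id S" and ?i = "act S (insert a S) id S"
  have "?p ` killed (insert a S) B = killed S B"
  proof
    show "?p ` killed (insert a S) B \<subseteq> killed S B"
      using fin B by (auto intro!: act_killed[where B = B])
    show "killed S B \<subseteq> ?p ` killed (insert a S) B"
    proof
      fix y assume y: "y \<in> killed S B"
      then have yS: "y \<in> carrier (V S)" by (simp add: killed_def)
      have "?p (?i y) = act S S id S y"
        using fin yS by (intro act_act) auto
      then have "?p (?i y) = y" using act_id fin yS by simp
      moreover have "?i y \<in> killed (insert a S) B"
        using fin B y by (intro act_killed[where B = B]) auto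
      ultimately show "y \<in> ?p ` killed (insert a S) B" by (metis imageI)
    qed
  qed
  moreover have "{x \<in> killed (insert a S) B. ?p x = \<zero>\<^bsub>V S\<^esub>} = killed (insert a S) (insert a B)"
    using a by (auto simp: killed_def)
  ultimately show ?thesis
    using dim_subspace_eq_image_plus_kernel[of R "V (insert a S)" "V S" ?p
        "killed (insert a S) B" "killed S B"] fd fin
    by (simp add: kdim_def V_vectorspace killed_subspace act_hom subset_insertI)
qed

text \<open>
  Each point of \<open>A\<close> is either removed from the set or added to the points at which vanishing is
  required. Recording the latter choices gives the subset \<open>T\<close>.
\<close>

lemma kdim_union_eq_sum:
  assumes fd: "\<And>S. finite S \<Longrightarrow> vectorspace.fin_dim R (V S)"
    and "finite A" "finite B" "A \<inter> B = {}"
  shows "kdim (A \<union> B) B = (\<Sum>T\<in>Pow A. kdim (T \<union> B) (T \<union> B))"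
  using assms(2-)
proof (induction A arbitrary: B rule: finite_induct)
  case empty
  then show ?case by simp
next
  case (insert a A)
  have "kdim (insert a A \<union> B) B = kdim (A \<union> B) B + kdim (A \<union> insert a B) (insert a B)"
    using kdim_insert[of a "A \<union> B" B] fd insert by simp
  also have "\<dots> = (\<Sum>T\<in>Pow A. kdim (T \<union> B) (T \<union> B)) +
      (\<Sum>T\<in>Pow A. kdim (insert a T \<union> B) (insert a T \<union> B))"
    using insert.IH[of B] insert.IH[of "insert a B"] insert.prems insert.hyps by simp
  also have "(\<Sum>T\<in>Pow A. kdim (insert a T \<union> B) (insert a T \<union> B)) =
      (\<Sum>T\<in>insert a ` Pow A. kdim (T \<union> B) (T \<union> B))"
    using insert.hyps by (subst sum.reindex) (auto simp: inj_on_def)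
  also have "(\<Sum>T\<in>Pow A. kdim (T \<union> B) (T \<union> B)) + \<dots> =
      (\<Sum>T\<in>Pow (insert a A). kdim (T \<union> B) (T \<union> B))"
    unfolding Pow_insert using insert.hyps by (intro sum.union_disjoint [symmetric]) auto
  finally show ?case .
qed

lemma kdim_cong_card:
  assumes fd: "\<And>S. finite S \<Longrightarrow> vectorspace.fin_dim R (V S)"
    and fin: "finite S" "finite T" and "card S = card T"
  shows "kdim S S = kdim T T"
proof -
  obtain \<sigma> where \<sigma>: "bij_betw \<sigma> S T"
    using assms finite_same_card_bij by blast
  then have "inj_on \<sigma> S" "\<sigma> ` S \<subseteq> T" by (simp_all add: bij_betw_def)
  then show ?thesis
    unfolding kdim_def using fin fd \<sigma>
    by (intro dim_subspace_eq_of_bij[where f = "act S T \<sigma> S"] V_vectorspace killed_subspace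
      act_hom bij_act) auto
qed

text \<open>
  The dimension \<open>w j\<close> of the piece at a set of \<open>j\<close> points is independent of that set, and
  \<open>S\<close> has \<open>card S choose j\<close> subsets with \<open>j\<close> elements.
\<close>

theorem dim_eq_binomial_sum:
  assumes fd: "\<And>S. finite S \<Longrightarrow> vectorspace.fin_dim R (V S)"
  shows "\<exists>w. \<forall>S. finite S \<longrightarrow>
    vectorspace.dim R (V S) = (\<Sum>j\<le>card S. (card S choose j) * w j)"
proof -
  \<comment> \<open>For a finite label type, \<open>w j\<close> is an unspecified value when no set has \<open>j\<close> elements. It is
      used only for \<open>j\<close> up to the cardinality of some \<open>S\<close>.\<close>
  define w where "w j = kdim (SOME T. finite T \<and> card T = j) (SOME T. finite T \<and> card T = j)" for j
  have w: "kdim T T = w (card T)" if "finite T" for T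
    unfolding w_def
    using that someI[of "\<lambda>U. finite U \<and> card U = card T" T] by (intro kdim_cong_card fd) auto
  have "vectorspace.dim R (V S) = (\<Sum>j\<le>card S. (card S choose j) * w j)"
    if "finite S" for S
  proof -
    have "killed S {} = carrier (V S)" by (simp add: killed_def)
    then have "vectorspace.dim R (V S) = kdim S {}"
      by (simp add: kdim_def)
    also have "\<dots> = (\<Sum>T\<in>Pow S. kdim T T)"
      using kdim_union_eq_sum[OF fd that, of "{}"] by simp
    also have "\<dots> = (\<Sum>T\<in>Pow S. w (card T))"
      using that by (intro sum.cong refl w) (auto intro: finite_subset)
    also have "\<dots> = (\<Sum>j\<le>card S. \<Sum>T | T \<in> Pow S \<and> card T = j. w (card T))"
      using that by (intro sum.group [symmetric]) (auto intro: card_mono)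
    also have "\<dots> = (\<Sum>j\<le>card S. (card S choose j) * w j)"
      using that by (intro sum.cong refl) (simp add: n_subsets)
    finally show ?thesis .
  qed
  then show ?thesis by blast
qed

end

section \<open>Binomial sums with polynomial growth\<close>

definition binomial_poly :: "nat \<Rightarrow> real poly" where
  "binomial_poly j = smult (1 / fact j) (\<Prod>i<j. [:- real i, 1:])"

lemma poly_binomial_poly: "poly (binomial_poly j) (real n) = real (n choose j)"
  by (simp add: binomial_poly_def poly_prod binomial_gbinomial gbinomial_prod_rev
      atLeast0LessThan)

lemma degree_binomial_poly: "degree (binomial_poly j) = j"
  by (simp add: binomial_poly_def degree_prod_eq_sum_degree)

lemma lead_coeff_binomial_poly: "lead_coeff (binomial_poly j) = 1 / fact j"
  unfolding binomial_poly_def by (simp add: lead_coeff_prod)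

text \<open>The difference has degree \<open>j\<close> and positive leading coefficient, so it tends to infinity.\<close>

lemma binomial_exceeds_poly:
  fixes p :: "real poly"
  assumes "degree p < j"
  shows "\<exists>n. poly p (real n) < real (n choose j)"
proof -
  let ?q = "binomial_poly j - p"
  have "degree ?q = j"
    using degree_add_eq_left[of "- p" "binomial_poly j"] assms by (simp add: degree_binomial_poly)
  then have "lead_coeff ?q = 1 / fact j"
    using lead_coeff_binomial_poly[of j] coeff_eq_0[OF assms] by (simp add: degree_binomial_poly)
  then have lc: "lead_coeff ?q > 0" by simp
  then obtain x0 where x0: "\<forall>x\<ge>x0. lead_coeff ?q \<le> poly ?q x"
    using poly_pinfty_gt_lc by blast
  obtain n where "real n \<ge> x0" using real_arch_simple by blast
  then have "poly ?q (real n) > 0" using x0 lc by force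
  then show ?thesis by (auto simp: poly_binomial_poly)
qed

text \<open>
  Nonnegativity of the coefficients is what makes the bound effective: each single term
  \<open>(n choose j) * w j\<close> is dominated by the polynomial, so \<open>w j\<close> vanishes beyond its degree.
\<close>

lemma binomial_sum_poly_of_poly_bound:
  fixes p :: "real poly" and w :: "nat \<Rightarrow> nat"
  assumes bound: "\<And>n. real (\<Sum>j\<le>n. (n choose j) * w j) \<le> poly p (real n)"
  shows "\<exists>q :: real poly. \<forall>n. real (\<Sum>j\<le>n. (n choose j) * w j) = poly q (real n)"
proof -
  have w0: "w j = 0" if j: "degree p < j" for j
  proof (rule ccontr)
    assume "w j \<noteq> 0"
    obtain n where n: "poly p (real n) < real (n choose j)"
      using binomial_exceeds_poly[OF j] by blast
    have "(n choose j) \<le> (\<Sum>j\<le>n. (n choose j) * w j)"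
    proof (cases "j \<le> n")
      case True
      have "(n choose j) \<le> (n choose j) * w j" using \<open>w j \<noteq> 0\<close> by simp
      also have "\<dots> \<le> (\<Sum>j\<le>n. (n choose j) * w j)"
        using True by (intro member_le_sum) auto
      finally show ?thesis .
    qed (simp add: not_le binomial_eq_0)
    with n bound[of n] show False by linarith
  qed
  define q where "q = (\<Sum>j\<le>degree p. smult (real (w j)) (binomial_poly j))"
  have "real (\<Sum>j\<le>n. (n choose j) * w j) = poly q (real n)" for n
  proof -
    \<comment> \<open>Both ends of the range may be moved: \<open>n choose j\<close> is zero for \<open>j > n\<close>, and \<open>w j\<close> is zero
        beyond the degree of \<open>p\<close>.\<close>
    have "(\<Sum>j\<le>n. (n choose j) * w j) = (\<Sum>j\<le>max n (degree p). (n choose j) * w j)"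
      by (intro sum.mono_neutral_left) auto
    also have "\<dots> = (\<Sum>j\<le>degree p. (n choose j) * w j)"
      using w0 by (intro sum.mono_neutral_right) auto
    finally show ?thesis
      by (simp add: q_def poly_sum poly_binomial_poly mult.commute)
  qed
  then show ?thesis by blast
qed

section \<open>Polynomial dimension\<close>

theorem theorem1p7:
  fixes K :: "('k, 'r) ring_scheme"
    and V :: "nat set \<Rightarrow> ('k, 'v, 'm) module_scheme"
    and Vmap :: "nat set \<Rightarrow> nat set \<Rightarrow> nat partial_inj \<Rightarrow> 'v \<Rightarrow> 'v"
  assumes "field K"
    and "FIsharp_module K V Vmap"
  shows "(\<exists>p :: real poly. \<forall>n :: nat.
            vectorspace.fin_dim K (V {1..n}) \<and>
            real (vectorspace.dim K (V {1..n})) \<le> poly p (real n))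
     \<longleftrightarrow> (\<exists>p :: real poly. \<forall>n :: nat.
            vectorspace.fin_dim K (V {1..n}) \<and>
            real (vectorspace.dim K (V {1..n})) = poly p (real n))"
proof
  interpret FIsharp_vectorspace K V Vmap
    using assms by (rule FIsharp_vectorspace.intro[rotated])
  assume "\<exists>p :: real poly. \<forall>n :: nat.
            vectorspace.fin_dim K (V {1..n}) \<and>
            real (vectorspace.dim K (V {1..n})) \<le> poly p (real n)"
  then obtain p :: "real poly" where fd: "\<And>n. vectorspace.fin_dim K (V {1..n})"
    and p: "\<And>n. real (vectorspace.dim K (V {1..n})) \<le> poly p (real n)" by blast
  \<comment> \<open>The decomposition of \<open>V {1..n}\<close> involves all subsets of \<open>{1..n}\<close>, not only initial segments.\<close>
  have "vectorspace.fin_dim K (V S)" if S: "finite S" for S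
  proof -
    have "card {1..card S} = card S" by simp
    then obtain \<sigma> where "bij_betw \<sigma> {1..card S} S"
      using finite_same_card_bij[OF finite_atLeastAtMost S] by blast
    then show ?thesis
      using fin_dim_of_bij[OF finite_atLeastAtMost S] fd by blast
  qed
  then obtain w where w: "\<And>S. finite S \<Longrightarrow>
      vectorspace.dim K (V S) = (\<Sum>j\<le>card S. (card S choose j) * w j)"
    using dim_eq_binomial_sum by blast
  have dim: "vectorspace.dim K (V {1..n}) = (\<Sum>j\<le>n. (n choose j) * w j)" for n
    using w[of "{1..n}"] by simp
  from p have "\<exists>q :: real poly. \<forall>n. real (\<Sum>j\<le>n. (n choose j) * w j) = poly q (real n)"
    unfolding dim by (rule binomial_sum_poly_of_poly_bound)
  then show "\<exists>p :: real poly. \<forall>n :: nat.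
            vectorspace.fin_dim K (V {1..n}) \<and>
            real (vectorspace.dim K (V {1..n})) = poly p (real n)"
    using fd unfolding dim by blast
qed (metis order_refl)

end
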